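(* Let $n>0$ and $0\le m\le n-1$ be integers. Let $t_1<\dots<t_n$ be the roots of $\psi_n$ in $(-1,1)$ and $W_j=\frac{1}{\psi_n'(t_j)}\int_{-1}^1\frac{\psi_n(s)\,ds}{s-t_j}$. Define $\Psi_n(y,t)=\int_0^y\psi_n(x)e^{-icxt}\,dx$ and $$P_{n,m}=\sum_{j=1}^n\frac{\psi_m(t_j)}{\psi_n'(t_j)}\Psi_n(1,t_j).$$ Let $I(t)=\frac{1}{\psi_n(t)}-\sum_{j=1}^n\frac{1}{\psi_n'(t_j)(t-t_j)}$ for $t\in(-1,1)$ and $\|I\|_\infty=\sup\{|I(t)|:-1<t<1\}$. Then $$\Big|\int_{-1}^1\psi_m(s)\,ds-\sum_{j=1}^n\psi_m(t_j)W_j\Big|\le\Big(1-\frac{|\lambda_n|^2}{|\lambda_m|^2}\Big)\|I\|_\infty+|\lambda_n|\Big(\frac{|\lambda_n|}{|\lambda_m|}|\psi_m(0)|+c|P_{n,m}|\Big).$$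
   Context: For a real number $c>0$, let $F_c[\varphi](x)=\int_{-1}^1\varphi(t)e^{icxt}\,dt$ on $L^2[-1,1]$, with eigenvalues $\lambda_0,\lambda_1,\dots$ ordered so that $|\lambda_n|\ge|\lambda_{n+1}|$ (nonzero, simple, $\lambda_n=i^n|\lambda_n|$) and corresponding real eigenfunctions $\psi_0,\psi_1,\dots$ (prolate spheroidal wave functions) with $\|\psi_n\|_{L^2[-1,1]}=1$, forming an orthonormal basis of $L^2[-1,1]$; $\psi_n$ has the parity of $n$ and exactly $n$ simple roots in $(-1,1)$. Each $\psi_n$ extends to an entire function via $\lambda_n\psi_n(x)=\int_{-1}^1\psi_n(t)e^{icxt}\,dt$. *)

theory Defs
  imports "HOL-Analysis.Analysis"
begin

text \<open>The prolate spheroidal wave functions for bandlimit c: a family psi of real functions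
  on the real line (restrictions of the entire extensions) with eigenvalues lam of the
  operator F_c, characterised by the standing assumptions of the paper.\<close>

definition pswf_system :: "real \<Rightarrow> (nat \<Rightarrow> complex) \<Rightarrow> (nat \<Rightarrow> real \<Rightarrow> real) \<Rightarrow> bool" where
  "pswf_system c lam psi \<longleftrightarrow>
     c > 0 \<and>
     (\<forall>k. continuous_on UNIV (psi k)) \<and>
     (\<forall>k. lam k \<noteq> 0) \<and>
     (\<forall>k x. lam k * complex_of_real (psi k x) =
              integral {-1..1} (\<lambda>t. complex_of_real (psi k t) * exp (\<i> * c * x * t))) \<and>
     (\<forall>k. norm (lam k) \<ge> norm (lam (Suc k))) \<and>
     (\<forall>j k. j \<noteq> k \<longrightarrow> lam j \<noteq> lam k) \<and>
     (\<forall>k. lam k = \<i> ^ k * complex_of_real (norm (lam k))) \<and>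
     (\<forall>j k. integral {-1..1} (\<lambda>x. psi j x * psi k x) = (if j = k then 1 else 0)) \<and>
     (\<forall>f::real \<Rightarrow> real. f integrable_on {-1..1} \<and> (\<lambda>x. (f x)^2) integrable_on {-1..1} \<and>
        (\<forall>k. integral {-1..1} (\<lambda>x. f x * psi k x) = 0)
        \<longrightarrow> integral {-1..1} (\<lambda>x. (f x)^2) = 0) \<and>
     (\<forall>k x. psi k (-x) = (-1)^k * psi k x) \<and>
     (\<forall>k. card {x. -1 < x \<and> x < 1 \<and> psi k x = 0} = k \<and>
          finite {x. -1 < x \<and> x < 1 \<and> psi k x = 0} \<and>
          (\<forall>x. -1 < x \<and> x < 1 \<and> psi k x = 0 \<longrightarrow> deriv (psi k) x \<noteq> 0))"

end

theory Submission
  imports Defs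
begin

text \<open>
  Let \<open>F\<close> be the band-limiting transform, \<open>t\<close> a root of \<open>psi n\<close>, and let \<open>phi\<close> solve
  \<open>phi' + i c t phi = - psi n\<close>, which is possible with \<open>phi (-1) = phi 1 = 0\<close> because \<open>t\<close> is a root.
  Integration by parts gives \<open>psi n s / (s - t) = (i c / lam n) F phi s\<close>. Applying the symmetry of \<open>F\<close>
  to this quotient and to \<open>(psi m s - psi m t) / (s - t)\<close> expresses both
  \<open>\<integral> psi m s psi n s / (s - t)\<close> and \<open>\<integral> psi n s (psi m s - psi m t) / (s - t)\<close> through \<open>\<integral> psi m phi\<close> and
  its complex conjugate; since the first integral is real, \<open>phi\<close> can be eliminated. With
  \<open>rho = |lam n|^2 / |lam m|^2\<close>, summation over the roots yields the exact error formula
  \<open>rho \<integral> psi m + (1 - rho) \<integral> psi m psi n I + i c lam n P\<close>, where \<open>\<integral> psi m = lam m psi m 0\<close>.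

  The supremum of \<open>|I|\<close> is meaningful only if \<open>psi n\<close> does not vanish at the endpoints. This follows
  from the differential equation of \<open>psi n\<close>, which holds because \<open>F\<close> commutes with the prolate
  differential operator and has simple eigenvalues.
\<close>

section \<open>The band-limiting transform\<close>

text \<open>\<open>c\<close> may be negative: for real functions, conjugating the transform amounts
  to replacing \<open>c\<close> by \<open>-c\<close>.\<close>

definition band_transform :: "real \<Rightarrow> (real \<Rightarrow> complex) \<Rightarrow> real \<Rightarrow> complex" where
  "band_transform c g x = integral {-1..1} (\<lambda>t. g t * exp (\<i> * c * x * t))"

text \<open>As a function of \<open>u\<close> this solves \<open>phi' + i c t phi = - g\<close> with
  \<open>phi 1 = 0\<close>.\<close>

definition exp_tail :: "real \<Rightarrow> (real \<Rightarrow> complex) \<Rightarrow> real \<Rightarrow> real \<Rightarrow> complex" where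
  "exp_tail c g t u = exp (- (\<i> * c * t * u)) * integral {u..1} (\<lambda>x. g x * exp (\<i> * c * t * x))"

lemma integral_complex_of_real_HK:
  assumes "f integrable_on S"
  shows "integral S (\<lambda>x. complex_of_real (f x)) = complex_of_real (integral S f)"
  by (intro integral_unique has_integral_of_real integrable_integral assms)

lemma exp_linear_has_vector_derivative:
  fixes a :: complex
  shows "((\<lambda>t::real. exp (a * t)) has_vector_derivative a * exp (a * x)) (at x within S)"
proof -
  have "((\<lambda>z. exp (a * z)) has_field_derivative a * exp (a * complex_of_real x)) (at (complex_of_real x))"
    by (auto intro!: derivative_eq_intros)
  then have "((\<lambda>t::real. exp (a * complex_of_real t)) has_vector_derivative a * exp (a * x)) (at x)"
    by (rule has_vector_derivative_real_field)
  then show ?thesis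
    by (rule has_vector_derivative_at_within)
qed

text \<open>Fubini for a continuous kernel. The second interval is left general because both
  \<open>{-1..1}\<close> and the half interval \<open>{-1..0}\<close> occur later.\<close>

lemma integral_exp_kernel_swap:
  fixes f g :: "real \<Rightarrow> complex"
  assumes "continuous_on {-1..1} f" "continuous_on {a..b} g"
  shows "integral {-1..1} (\<lambda>s. f s * integral {a..b} (\<lambda>u. g u * exp (\<i> * c * s * u)))
       = integral {a..b} (\<lambda>u. g u * band_transform c f u)"
proof -
  have cont: "continuous_on (cbox (-1,a) (1,b)) (\<lambda>(s,u). f s * (g u * exp (\<i> * c * s * u)))"
    unfolding split_beta cbox_Pair_eq
    by (intro continuous_intros continuous_on_compose2[OF assms(1)] continuous_on_compose2[OF assms(2)]) auto
  have "integral {-1..1} (\<lambda>s. f s * integral {a..b} (\<lambda>u. g u * exp (\<i> * c * s * u)))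
      = integral {-1..1} (\<lambda>s. integral {a..b} (\<lambda>u. f s * (g u * exp (\<i> * c * s * u))))"
    by simp
  also have "\<dots> = integral {a..b} (\<lambda>u. integral {-1..1} (\<lambda>s. f s * (g u * exp (\<i> * c * s * u))))"
    using integral_swap_continuous[OF cont] by simp
  also have "\<dots> = integral {a..b} (\<lambda>u. integral {-1..1} (\<lambda>s. g u * (f s * exp (\<i> * c * u * s))))"
    by (simp add: mult_ac)
  also have "\<dots> = integral {a..b} (\<lambda>u. g u * band_transform c f u)"
    by (simp add: band_transform_def)
  finally show ?thesis .
qed

text \<open>The kernel is symmetric in its two variables, so the transform is symmetric for the
  bilinear pairing, without conjugation.\<close>

lemma band_transform_symmetric:
  assumes "continuous_on {-1..1} f" "continuous_on {-1..1} g"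
  shows "integral {-1..1} (\<lambda>s. f s * band_transform c g s) = integral {-1..1} (\<lambda>s. g s * band_transform c f s)"
  using integral_exp_kernel_swap[OF assms] by (simp add: band_transform_def)

text \<open>Differentiation under the integral sign. The derivative is again a transform of a
  continuous function, so the step can be repeated.\<close>

lemma band_transform_has_vector_derivative:
  assumes "continuous_on {-1..1} g"
  shows "(band_transform c g has_vector_derivative band_transform c (\<lambda>t. \<i> * c * t * g t) x) (at x)"
proof -
  have "((\<lambda>x. integral (cbox (-1) 1) (\<lambda>t. g t * exp (\<i> * c * x * t))) has_vector_derivative
      integral (cbox (-1) 1) (\<lambda>t. \<i> * c * t * g t * exp (\<i> * c * x * t))) (at x within UNIV)"
  proof (rule leibniz_rule_vector_derivative)
    fix x t :: real
    have "((\<lambda>x. g t * exp (\<i> * c * t * complex_of_real x)) has_vector_derivative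
      g t * (\<i> * c * t * exp (\<i> * c * t * x))) (at x)"
      by (rule has_vector_derivative_mult_right) (rule exp_linear_has_vector_derivative)
    then show "((\<lambda>x. g t * exp (\<i> * c * x * t)) has_vector_derivative
      \<i> * c * t * g t * exp (\<i> * c * x * t)) (at x within UNIV)"
      by (simp add: mult_ac)
  next
    fix x :: real
    show "(\<lambda>t. g t * exp (\<i> * c * x * t)) integrable_on cbox (-1) 1"
      using assms by (auto intro!: integrable_continuous_interval continuous_intros)
  next
    show "continuous_on (UNIV \<times> cbox (-1) 1) (\<lambda>(x::real, t). \<i> * c * t * g t * exp (\<i> * c * x * t))"
      unfolding split_beta
      by (intro continuous_intros continuous_on_compose2[OF assms]) auto
  qed auto
  then show ?thesis
    by (simp add: band_transform_def[abs_def])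
qed

lemma continuous_on_band_transform:
  assumes "continuous_on {-1..1} g"
  shows "continuous_on S (band_transform c g)"
  by (rule continuous_on_subset[of UNIV])
     (auto intro!: continuous_at_imp_continuous_on
        has_vector_derivative_continuous[OF band_transform_has_vector_derivative[OF assms]])

section \<open>The first-order equation solved by \<open>exp_tail\<close>\<close>

lemma exp_tail_has_vector_derivative:
  assumes g: "continuous_on {-1..1} g" and u: "u \<in> {-1..1}"
  shows "(exp_tail c g t has_vector_derivative - (\<i> * c * t) * exp_tail c g t u - g u) (at u within {-1..1})"
proof -
  define h where "h = (\<lambda>x. g x * exp (\<i> * c * t * x))"
  have h: "continuous_on {-1..1} h"
    unfolding h_def by (intro continuous_intros g)
  have tail: "integral {v..1} h = integral {-1..1} h - integral {-1..v} h" if "v \<in> {-1..1}" for v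
    using Henstock_Kurzweil_Integration.integral_combine[of "-1" v 1 h] that
      integrable_continuous_interval[OF h] by (auto simp: algebra_simps)
  have "((\<lambda>v. integral {-1..1} h - integral {-1..v} h) has_vector_derivative (0 - h u)) (at u within {-1..1})"
    by (intro derivative_intros integral_has_vector_derivative h u)
  then have "((\<lambda>v. integral {v..1} h) has_vector_derivative - h u) (at u within {-1..1})"
    using has_vector_derivative_transform[OF u tail] by fastforce
  then have deriv: "((\<lambda>v. exp ((-(\<i> * c * t)) * v) * integral {v..1} h) has_vector_derivative
     exp ((-(\<i> * c * t)) * u) * (- h u) + (-(\<i> * c * t)) * exp ((-(\<i> * c * t)) * u) * integral {u..1} h) (at u within {-1..1})"
    by (intro has_vector_derivative_mult exp_linear_has_vector_derivative)
  have T: "exp_tail c g t = (\<lambda>v. exp ((-(\<i> * c * t)) * v) * integral {v..1} h)"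
    by (simp add: exp_tail_def[abs_def] h_def)
  have "exp ((-(\<i> * c * t)) * u) * (- h u) = - g u"
    by (simp add: h_def exp_minus)
  then have "exp ((-(\<i> * c * t)) * u) * (- h u) + (-(\<i> * c * t)) * exp ((-(\<i> * c * t)) * u) * integral {u..1} h
      = - (\<i> * c * t) * exp_tail c g t u - g u"
    by (simp add: T)
  then show ?thesis
    using deriv by (simp only: T)
qed

lemma continuous_on_exp_tail:
  assumes "continuous_on {-1..1} g"
  shows "continuous_on {-1..1} (exp_tail c g t)"
  using exp_tail_has_vector_derivative[OF assms] has_vector_derivative_continuous
  by (metis continuous_on_eq_continuous_within)

lemma exp_tail_right [simp]: "exp_tail c g t 1 = 0"
  by (simp add: exp_tail_def)

text \<open>Hence the solution vanishes at both ends exactly when the transform of \<open>g\<close>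
  vanishes at \<open>t\<close>; for an eigenfunction this means that \<open>t\<close> is a
  root.\<close>

lemma exp_tail_left: "exp_tail c g t (-1) = exp (\<i> * c * t) * band_transform c g t"
  by (simp add: exp_tail_def band_transform_def)

lemma cnj_exp_tail:
  "cnj (exp_tail c (\<lambda>x. complex_of_real (f x)) t u) = exp_tail (-c) (\<lambda>x. complex_of_real (f x)) t u"
  by (simp add: exp_tail_def exp_cnj integral_cnj)

text \<open>Integrating the derivative of \<open>exp_tail c g t u * exp (i c s u)\<close> over
  \<open>{-1..1}\<close> leaves only the boundary term at \<open>-1\<close>. If the transform of
  \<open>g\<close> vanishes at \<open>t\<close>, this divides it by \<open>s - t\<close>.\<close>

lemma band_transform_exp_tail:
  assumes g: "continuous_on {-1..1} g"
  shows "\<i> * c * (s - t) * band_transform c (exp_tail c g t) s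
       = band_transform c g s - exp (- (\<i> * c * (s - t))) * band_transform c g t"
proof -
  let ?T = "exp_tail c g t"
  have T: "continuous_on {-1..1} ?T"
    by (rule continuous_on_exp_tail[OF g])
  have "((\<lambda>u. ?T u * (\<i> * c * s * exp (\<i> * c * s * u)) + (- (\<i> * c * t) * ?T u - g u) * exp (\<i> * c * s * u))
     has_integral ?T 1 * exp (\<i> * c * s * of_real 1) - ?T (-1) * exp (\<i> * c * s * of_real (-1))) {-1..1}"
    by (intro fundamental_theorem_of_calculus has_vector_derivative_mult exp_tail_has_vector_derivative g
        exp_linear_has_vector_derivative) auto
  then have "((\<lambda>u. \<i> * c * (s - t) * (?T u * exp (\<i> * c * s * u)) - g u * exp (\<i> * c * s * u))
     has_integral - exp (- (\<i> * c * (s - t))) * band_transform c g t) {-1..1}"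
    by (simp add: exp_tail_left algebra_simps flip: exp_add)
  moreover have "((\<lambda>u. \<i> * c * (s - t) * (?T u * exp (\<i> * c * s * u)) - g u * exp (\<i> * c * s * u))
     has_integral \<i> * c * (s - t) * band_transform c ?T s - band_transform c g s) {-1..1}"
    unfolding band_transform_def
    by (intro has_integral_diff has_integral_mult_right integrable_integral integrable_continuous_interval
        continuous_intros g T)
  ultimately have "\<i> * c * (s - t) * band_transform c ?T s - band_transform c g s
      = - exp (- (\<i> * c * (s - t))) * band_transform c g t"
    using has_integral_unique by blast
  then show ?thesis by (simp add: algebra_simps)
qed

text \<open>In the derivative of the product of the two solutions the terms with
  \<open>i c t\<close> cancel, the signs of \<open>c\<close> being opposite. The product vanishes at
  \<open>1\<close> by construction and at \<open>-1\<close> by \<open>zero\<close>.\<close>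

lemma integral_exp_tail_exchange:
  assumes g: "continuous_on {-1..1} g" and h: "continuous_on {-1..1} h"
    and zero: "band_transform (-c) h t = 0"
  shows "integral {-1..1} (\<lambda>u. h u * exp_tail c g t u) = - integral {-1..1} (\<lambda>u. g u * exp_tail (-c) h t u)"
proof -
  let ?S = "exp_tail c g t" and ?T = "exp_tail (-c) h t"
  have "((\<lambda>u. ?S u * (- (\<i> * complex_of_real (-c) * t) * ?T u - h u) + (- (\<i> * c * t) * ?S u - g u) * ?T u)
     has_integral ?S 1 * ?T 1 - ?S (-1) * ?T (-1)) {-1..1}"
    by (intro fundamental_theorem_of_calculus has_vector_derivative_mult exp_tail_has_vector_derivative g h) auto
  then have 1: "((\<lambda>u. - (h u * ?S u) - g u * ?T u) has_integral 0) {-1..1}"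
    using zero by (simp add: exp_tail_left[of "-c"] algebra_simps)
  have 2: "((\<lambda>u. - (h u * ?S u) - g u * ?T u) has_integral
      - integral {-1..1} (\<lambda>u. h u * ?S u) - integral {-1..1} (\<lambda>u. g u * ?T u)) {-1..1}"
    by (intro has_integral_diff has_integral_neg integrable_integral integrable_continuous_interval
        continuous_intros g h continuous_on_exp_tail)
  show ?thesis
    using has_integral_unique[OF 1 2] by algebra
qed

section \<open>Conjugation, boundedness on compact sets, real derivatives\<close>

lemma cnj_band_transform_of_real:
  "cnj (band_transform c (\<lambda>x. complex_of_real (f x)) t) = band_transform (-c) (\<lambda>x. complex_of_real (f x)) t"
  by (simp add: band_transform_def exp_cnj integral_cnj)

text \<open>A limit bounds \<open>f\<close> on a punctured neighbourhood, and adding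
  \<open>|f z|\<close> covers the point itself, whatever value \<open>f\<close> takes there. By
  compactness finitely many neighbourhoods suffice.\<close>

lemma bounded_image_if_limits_on_compact:
  fixes f :: "'a::t2_space \<Rightarrow> real"
  assumes "compact S" and lim: "\<And>z. z \<in> S \<Longrightarrow> \<exists>l. (f \<longlongrightarrow> l) (at z)"
  shows "\<exists>B. \<forall>x\<in>S. \<bar>f x\<bar> \<le> B"
proof -
  have "\<exists>U B. open U \<and> z \<in> U \<and> (\<forall>x\<in>U. \<bar>f x\<bar> \<le> B)" if "z \<in> S" for z
  proof -
    obtain l where l: "(f \<longlongrightarrow> l) (at z)"
      using lim[OF \<open>z \<in> S\<close>] by blast
    have "\<forall>\<^sub>F x in at z. \<bar>f x\<bar> < \<bar>l\<bar> + 1"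
      by (rule order_tendstoD(2)[OF tendsto_rabs[OF l]]) simp
    then obtain U where "open U" "z \<in> U" "\<forall>x\<in>U. x \<noteq> z \<longrightarrow> \<bar>f x\<bar> < \<bar>l\<bar> + 1"
      unfolding eventually_at_topological by auto
    then show ?thesis
      by (intro exI[of _ U] exI[of _ "\<bar>l\<bar> + 1 + \<bar>f z\<bar>"]) fastforce
  qed
  then obtain U B where UB: "\<And>z. z \<in> S \<Longrightarrow> open (U z)" "\<And>z. z \<in> S \<Longrightarrow> z \<in> U z"
      "\<And>z x. z \<in> S \<Longrightarrow> x \<in> U z \<Longrightarrow> \<bar>f x\<bar> \<le> B z"
    by metis
  obtain T where T: "T \<subseteq> S" "finite T" "S \<subseteq> (\<Union>z\<in>T. U z)"
    using compactE_image[OF \<open>compact S\<close>, of S U] UB(1,2) by blast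
  have "\<bar>f x\<bar> \<le> (\<Sum>z\<in>T. \<bar>B z\<bar>)" if x: "x \<in> S" for x
  proof -
    obtain z where z: "z \<in> T" "x \<in> U z"
      using T x by blast
    then have "\<bar>f x\<bar> \<le> \<bar>B z\<bar>"
      using UB(3)[of z x] T by fastforce
    also have "\<dots> \<le> (\<Sum>z\<in>T. \<bar>B z\<bar>)"
      using T z by (intro member_le_sum) auto
    finally show ?thesis .
  qed
  then show ?thesis by blast
qed

text \<open>Taking real parts gives a real derivative; uniqueness of derivatives then shows that
  \<open>D\<close> was real already.\<close>

lemma has_real_derivative_if_of_real:
  assumes "((\<lambda>x. complex_of_real (f x)) has_vector_derivative D) (at x)"
  shows "(f has_real_derivative Re D) (at x)" and "complex_of_real (Re D) = D"
proof -
  have "((\<lambda>x. Re (complex_of_real (f x))) has_vector_derivative Re D) (at x)"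
    using bounded_linear.has_vector_derivative[OF bounded_linear_Re assms] .
  then show *: "(f has_real_derivative Re D) (at x)"
    by (simp add: has_real_derivative_iff_has_vector_derivative)
  have "((\<lambda>x. complex_of_real (f x)) has_vector_derivative complex_of_real (Re D)) (at x)"
    by (rule has_vector_derivative_of_real) (use * in \<open>simp add: has_real_derivative_iff_has_vector_derivative\<close>)
  then show "complex_of_real (Re D) = D"
    using assms vector_derivative_unique_at by blast
qed

section \<open>Differential equation and endpoint values\<close>

locale pswf =
  fixes c :: real and lam :: "nat \<Rightarrow> complex" and psi :: "nat \<Rightarrow> real \<Rightarrow> real"
  assumes sys: "pswf_system c lam psi"
begin

abbreviation cpsi :: "nat \<Rightarrow> real \<Rightarrow> complex" where
  "cpsi k \<equiv> \<lambda>x. complex_of_real (psi k x)"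

lemma c_pos: "c > 0"
  and continuous_psi: "continuous_on UNIV (psi k)"
  and lam_nonzero [simp]: "lam k \<noteq> 0"
  and norm_lam_Suc_le: "norm (lam (Suc k)) \<le> norm (lam k)"
  and lam_distinct: "j \<noteq> k \<Longrightarrow> lam j \<noteq> lam k"
  and psi_orthonormal: "integral {-1..1} (\<lambda>x. psi j x * psi k x) = (if j = k then 1 else 0)"
  and psi_parity: "psi k (-x) = (-1)^k * psi k x"
  and finite_zeros: "finite {x. -1 < x \<and> x < 1 \<and> psi k x = 0}"
  and simple_zeros: "-1 < x \<Longrightarrow> x < 1 \<Longrightarrow> psi k x = 0 \<Longrightarrow> deriv (psi k) x \<noteq> 0"
  using sys unfolding pswf_system_def by simp_all

lemma psi_complete:
  assumes "f integrable_on {-1..1}" "(\<lambda>x. (f x)^2) integrable_on {-1..1}"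
    and "\<And>k. integral {-1..1} (\<lambda>x. f x * psi k x) = 0"
  shows "integral {-1..1} (\<lambda>x. (f x)^2) = 0"
proof -
  have "\<forall>f::real \<Rightarrow> real. f integrable_on {-1..1} \<and> (\<lambda>x. (f x)^2) integrable_on {-1..1} \<and>
        (\<forall>k. integral {-1..1} (\<lambda>x. f x * psi k x) = 0)
        \<longrightarrow> integral {-1..1} (\<lambda>x. (f x)^2) = 0"
    using sys unfolding pswf_system_def by (elim conjE)
  then show ?thesis
    using assms by blast
qed

lemma band_transform_psi: "band_transform c (cpsi k) x = lam k * cpsi k x"
  using sys unfolding pswf_system_def band_transform_def by simp

lemma norm_lam_antimono: "j \<le> k \<Longrightarrow> norm (lam k) \<le> norm (lam j)"
  by (rule lift_Suc_antimono_le[of "\<lambda>k. norm (lam k)"]) (auto simp: norm_lam_Suc_le)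

lemma continuous_on_psi [continuous_intros]:
  "continuous_on S f \<Longrightarrow> continuous_on S (\<lambda>x. psi k (f x))"
  by (rule continuous_on_compose2[OF continuous_psi]) auto

section \<open>Derivatives of the eigenfunctions\<close>

definition dpsi :: "nat \<Rightarrow> real \<Rightarrow> real" where
  "dpsi k x = Re (band_transform c (\<lambda>t. \<i> * c * t * cpsi k t) x / lam k)"

definition d2psi :: "nat \<Rightarrow> real \<Rightarrow> real" where
  "d2psi k x = Re (band_transform c (\<lambda>t. \<i> * c * t * (\<i> * c * t * cpsi k t)) x / lam k)"

text \<open>Dividing the eigenvalue equation by \<open>lam k\<close> writes \<open>psi k\<close> as
  a transform, which can be differentiated. As \<open>psi k\<close> is real, the \<open>Re\<close>
  in \<open>dpsi\<close> loses nothing.\<close>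

lemma psi_has_derivative: "(psi k has_real_derivative dpsi k x) (at x)"
  and of_real_dpsi: "lam k * complex_of_real (dpsi k x) = band_transform c (\<lambda>t. \<i> * c * t * cpsi k t) x"
proof -
  have eq: "cpsi k = (\<lambda>x. band_transform c (cpsi k) x / lam k)"
    by (simp add: band_transform_psi)
  have "((\<lambda>x. band_transform c (cpsi k) x / lam k) has_vector_derivative
      band_transform c (\<lambda>t. \<i> * c * t * cpsi k t) x / lam k) (at x)"
    by (intro has_vector_derivative_divide band_transform_has_vector_derivative continuous_intros)
  note * = has_real_derivative_if_of_real[OF this[folded eq], folded dpsi_def]
  show "(psi k has_real_derivative dpsi k x) (at x)" by (fact *(1))
  show "lam k * complex_of_real (dpsi k x) = band_transform c (\<lambda>t. \<i> * c * t * cpsi k t) x"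
    by (simp add: *(2))
qed

lemma dpsi_has_derivative: "(dpsi k has_real_derivative d2psi k x) (at x)"
  and of_real_d2psi: "lam k * complex_of_real (d2psi k x)
      = band_transform c (\<lambda>t. \<i> * c * t * (\<i> * c * t * cpsi k t)) x"
proof -
  have eq: "(\<lambda>x. complex_of_real (dpsi k x)) = (\<lambda>x. band_transform c (\<lambda>t. \<i> * c * t * cpsi k t) x / lam k)"
    by (simp flip: of_real_dpsi)
  have "((\<lambda>x. band_transform c (\<lambda>t. \<i> * c * t * cpsi k t) x / lam k) has_vector_derivative
      band_transform c (\<lambda>t. \<i> * c * t * (\<i> * c * t * cpsi k t)) x / lam k) (at x)"
    by (intro has_vector_derivative_divide band_transform_has_vector_derivative continuous_intros)
  note * = has_real_derivative_if_of_real[OF this[folded eq], folded d2psi_def]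
  show "(dpsi k has_real_derivative d2psi k x) (at x)" by (fact *(1))
  show "lam k * complex_of_real (d2psi k x) = band_transform c (\<lambda>t. \<i> * c * t * (\<i> * c * t * cpsi k t)) x"
    by (simp add: *(2))
qed

lemma deriv_psi: "deriv (psi k) x = dpsi k x"
  using psi_has_derivative by (rule DERIV_imp_deriv)

lemma continuous_on_dpsi [continuous_intros]: "continuous_on S (dpsi k)"
  by (rule DERIV_continuous_on, rule has_field_derivative_at_within, rule dpsi_has_derivative)

lemma continuous_on_d2psi [continuous_intros]: "continuous_on S (d2psi k)"
  unfolding d2psi_def[abs_def]
  by (intro continuous_intros continuous_on_band_transform) auto

text \<open>The prolate differential operator \<open>((1 - x^2) psi')' - c^2 x^2 psi\<close> in
  expanded form.\<close>

definition prolate_op :: "nat \<Rightarrow> real \<Rightarrow> real" where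
  "prolate_op k x = (1 - x\<^sup>2) * d2psi k x - 2 * x * dpsi k x - c\<^sup>2 * x\<^sup>2 * psi k x"

lemma continuous_on_prolate_op [continuous_intros]: "continuous_on S (prolate_op k)"
  unfolding prolate_op_def[abs_def] by (intro continuous_intros)

text \<open>The kernel satisfies the same equation in both variables, so that the differential operator
  commutes with the transform: the boundary terms vanish because of the factor \<open>1 - t\<^sup>2\<close>.\<close>

lemma band_transform_prolate_op:
  "band_transform c (\<lambda>t. complex_of_real (prolate_op k t)) x = lam k * complex_of_real (prolate_op k x)"
proof -
  let ?E = "\<lambda>t::real. exp (\<i> * c * x * t)"
  \<comment> \<open>\<open>?q\<close> is the factor by which the prolate operator in
    \<open>x\<close> multiplies the kernel; the operator in \<open>t\<close> produces the same
    factor.\<close>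
  let ?q = "\<lambda>t::real. (1 - x\<^sup>2) * (\<i> * c * t)^2 - 2 * x * (\<i> * c * t) - c\<^sup>2 * x\<^sup>2 :: complex"
  let ?h = "\<lambda>t. complex_of_real (prolate_op k t)"
  have d0: "(cpsi k has_vector_derivative complex_of_real (dpsi k t)) (at t within {-1..1})" for t
    by (rule has_vector_derivative_at_within, rule has_vector_derivative_of_real)
       (use psi_has_derivative in \<open>simp add: has_real_derivative_iff_has_vector_derivative\<close>)
  have d1: "((\<lambda>t. complex_of_real (dpsi k t)) has_vector_derivative complex_of_real (d2psi k t)) (at t within {-1..1})" for t
    by (rule has_vector_derivative_at_within, rule has_vector_derivative_of_real)
       (use dpsi_has_derivative in \<open>simp add: has_real_derivative_iff_has_vector_derivative\<close>)
  have dw: "((\<lambda>t. complex_of_real (1 - t\<^sup>2)) has_vector_derivative complex_of_real (- 2 * t)) (at t within {-1..1})" for t :: real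
    by (rule has_vector_derivative_of_real)
       (auto simp flip: has_real_derivative_iff_has_vector_derivative intro!: derivative_eq_intros)
  note dE = exp_linear_has_vector_derivative[where a = "\<i> * c * x" and S = "{-1..1}"]
  \<comment> \<open>\<open>?G\<close> is \<open>(1 - t^2) (psi' E - psi E')\<close>, the boundary
    expression of Lagrange's identity. With \<open>L\<close> the operator in \<open>t\<close>, its
    derivative is \<open>(L psi) E - psi (L E)\<close>.\<close>
  let ?G = "\<lambda>t. complex_of_real (1 - t\<^sup>2) * (complex_of_real (dpsi k t) * ?E t - cpsi k t * (\<i> * c * x * ?E t))"
  have dG: "(?G has_vector_derivative
      complex_of_real (1 - t\<^sup>2) * ((complex_of_real (dpsi k t) * (\<i> * c * x * ?E t) + complex_of_real (d2psi k t) * ?E t)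
        - (cpsi k t * (\<i> * c * x * (\<i> * c * x * ?E t)) + complex_of_real (dpsi k t) * (\<i> * c * x * ?E t)))
      + complex_of_real (- 2 * t) * (complex_of_real (dpsi k t) * ?E t - cpsi k t * (\<i> * c * x * ?E t)))
     (at t within {-1..1})" for t
    by (intro has_vector_derivative_mult has_vector_derivative_diff has_vector_derivative_mult_right d0 d1 dw dE)
  have eq: "complex_of_real (1 - t\<^sup>2) * ((complex_of_real (dpsi k t) * (\<i> * c * x * ?E t) + complex_of_real (d2psi k t) * ?E t)
        - (cpsi k t * (\<i> * c * x * (\<i> * c * x * ?E t)) + complex_of_real (dpsi k t) * (\<i> * c * x * ?E t)))
      + complex_of_real (- 2 * t) * (complex_of_real (dpsi k t) * ?E t - cpsi k t * (\<i> * c * x * ?E t))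
      = ?h t * ?E t - ?q t * (cpsi k t * ?E t)" for t
    by (simp add: prolate_op_def algebra_simps power2_eq_square)
  have "((\<lambda>t. ?h t * ?E t - ?q t * (cpsi k t * ?E t)) has_integral ?G 1 - ?G (-1)) {-1..1}"
    using dG unfolding eq by (intro fundamental_theorem_of_calculus) simp_all
  then have 1: "((\<lambda>t. ?h t * ?E t - ?q t * (cpsi k t * ?E t)) has_integral 0) {-1..1}"
    by simp
  have 2: "((\<lambda>t. ?h t * ?E t) has_integral band_transform c ?h x) {-1..1}"
    unfolding band_transform_def
    by (intro integrable_integral integrable_continuous_interval continuous_intros)
  \<comment> \<open>The other half: applying the operator in \<open>x\<close> under the integral
    sign of the eigenvalue equation brings out the same \<open>?q\<close>.\<close>
  have "((\<lambda>t. (1 - x\<^sup>2) * ((\<i> * c * t * (\<i> * c * t * cpsi k t)) * ?E t)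
       - 2 * x * (\<i> * c * t * cpsi k t * ?E t) - c\<^sup>2 * x\<^sup>2 * (cpsi k t * ?E t)) has_integral
      (1 - x\<^sup>2) * (lam k * d2psi k x) - 2 * x * (lam k * dpsi k x) - c\<^sup>2 * x\<^sup>2 * (lam k * psi k x)) {-1..1}"
    unfolding of_real_dpsi of_real_d2psi band_transform_psi[symmetric] unfolding band_transform_def
    by (intro has_integral_diff has_integral_mult_right integrable_integral integrable_continuous_interval
        continuous_intros)
  moreover have "(1 - x\<^sup>2) * ((\<i> * c * t * (\<i> * c * t * cpsi k t)) * ?E t)
       - 2 * x * (\<i> * c * t * cpsi k t * ?E t) - c\<^sup>2 * x\<^sup>2 * (cpsi k t * ?E t) = ?q t * (cpsi k t * ?E t)" for t
    by (simp add: algebra_simps power2_eq_square)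
  moreover have "(1 - x\<^sup>2) * (lam k * d2psi k x) - 2 * x * (lam k * dpsi k x) - c\<^sup>2 * x\<^sup>2 * (lam k * psi k x)
      = lam k * ?h x"
    by (simp add: prolate_op_def algebra_simps)
  ultimately have 3: "((\<lambda>t. ?q t * (cpsi k t * ?E t)) has_integral lam k * ?h x) {-1..1}"
    by (simp only:)
  show ?thesis
    using has_integral_unique[OF 1 has_integral_diff[OF 2 3]] by simp
qed

text \<open>By commutation, \<open>prolate_op k\<close> satisfies the eigenvalue equation for
  \<open>lam k\<close>, so it is orthogonal to every other \<open>psi j\<close>, the eigenvalues
  being distinct. Completeness leaves only a multiple of \<open>psi k\<close>.\<close>

lemma prolate_op_eigen:
  obtains a where "\<And>x. x \<in> {-1..1} \<Longrightarrow> prolate_op k x = a * psi k x"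
proof -
  define a where "a = integral {-1..1} (\<lambda>x. prolate_op k x * psi k x)"
  define f where "f x = prolate_op k x - a * psi k x" for x
  have contf: "continuous_on S f" for S
    unfolding f_def by (intro continuous_intros)
  have orth: "integral {-1..1} (\<lambda>x. prolate_op k x * psi j x) = 0" if "j \<noteq> k" for j
  proof -
    let ?h = "\<lambda>t. complex_of_real (prolate_op k t)"
    let ?J = "integral {-1..1} (\<lambda>x. ?h x * cpsi j x)"
    have "lam j * ?J = integral {-1..1} (\<lambda>x. ?h x * band_transform c (cpsi j) x)"
      by (simp add: band_transform_psi mult.left_commute)
    also have "\<dots> = integral {-1..1} (\<lambda>x. cpsi j x * band_transform c ?h x)"
      by (intro band_transform_symmetric continuous_intros)
    also have "\<dots> = lam k * ?J"
      by (simp add: band_transform_prolate_op mult_ac)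
    finally have "?J = 0"
      using lam_distinct[OF that] by simp
    moreover have "?J = complex_of_real (integral {-1..1} (\<lambda>x. prolate_op k x * psi j x))"
      by (subst integral_complex_of_real_HK[symmetric])
         (auto intro!: integrable_continuous_interval continuous_intros)
    ultimately show ?thesis by simp
  qed
  have "integral {-1..1} (\<lambda>x. f x * psi j x) = 0" for j
  proof -
    have "((\<lambda>x. prolate_op k x * psi j x - a * (psi k x * psi j x)) has_integral
        integral {-1..1} (\<lambda>x. prolate_op k x * psi j x) - a * integral {-1..1} (\<lambda>x. psi k x * psi j x)) {-1..1}"
      by (intro has_integral_diff has_integral_mult_right integrable_integral integrable_continuous_interval
          continuous_intros)
    then have "integral {-1..1} (\<lambda>x. f x * psi j x)
        = integral {-1..1} (\<lambda>x. prolate_op k x * psi j x) - a * (if k = j then 1 else 0)"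
      by (simp add: f_def algebra_simps integral_unique psi_orthonormal)
    then show ?thesis
      using orth[of j] by (auto simp: a_def split: if_splits)
  qed
  then have "integral {-1..1} (\<lambda>x. (f x)^2) = 0"
    by (intro psi_complete integrable_continuous_interval continuous_intros contf)
  \<comment> \<open>Continuity turns vanishing in mean square into vanishing at every point,
    endpoints included.\<close>
  then have "\<forall>x\<in>{-1..1}. (f x)\<^sup>2 = 0"
    by (subst (asm) integral_eq_0_iff) (auto intro!: continuous_intros contf)
  then show ?thesis
    by (intro that[of a]) (auto simp: f_def)
qed

text \<open>If \<open>psi k\<close> vanished at \<open>1\<close>, integrating the differential equation from the singular endpoint
  would bound \<open>psi k\<close> near \<open>1\<close> by a small multiple of its own supremum.\<close>

lemma psi_one_nonzero: "psi k 1 \<noteq> 0"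
proof
  assume zero: "psi k 1 = 0"
  obtain a where a: "\<And>x. x \<in> {-1..1} \<Longrightarrow> prolate_op k x = a * psi k x"
    using prolate_op_eigen by blast
  \<comment> \<open>\<open>C\<close> bounds \<open>|a + c^2 x^2|\<close> on \<open>{-1..1}\<close>,
    and its summand 1 ensures \<open>b >= 0\<close>. The point \<open>b\<close> is chosen so that
    \<open>C * (1 - b) = 1/2\<close> serves as contraction factor.\<close>
  define C where "C = \<bar>a\<bar> + c\<^sup>2 + 1"
  define b where "b = 1 - 1 / (2 * C)"
  have C1: "C \<ge> 1" by (simp add: C_def)
  then have b: "0 \<le> b" "b < 1" "C * (1 - b) = 1/2"
    by (auto simp: b_def field_simps)
  have "\<exists>y\<in>{b..1}. \<forall>x\<in>{b..1}. \<bar>psi k x\<bar> \<le> \<bar>psi k y\<bar>"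
    using b by (intro continuous_attains_sup continuous_intros) auto
  then obtain y where y: "y \<in> {b..1}" and max: "\<And>x. x \<in> {b..1} \<Longrightarrow> \<bar>psi k x\<bar> \<le> \<bar>psi k y\<bar>"
    by blast
  define M where "M = \<bar>psi k y\<bar>"
  \<comment> \<open>The differential equation in divergence form. The differentiated function
    vanishes at \<open>1\<close>, so the mean value theorem between \<open>x\<close> and
    \<open>1\<close> controls it.\<close>
  have w: "((\<lambda>x. (1 - x\<^sup>2) * dpsi k x) has_real_derivative (a + c\<^sup>2 * x\<^sup>2) * psi k x) (at x)"
    if "x \<in> {-1..1}" for x
  proof -
    have "((\<lambda>x. (1 - x\<^sup>2) * dpsi k x) has_real_derivative (1 - x\<^sup>2) * d2psi k x - 2 * x * dpsi k x) (at x)"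
      by (auto intro!: derivative_eq_intros dpsi_has_derivative)
    moreover have "(1 - x\<^sup>2) * d2psi k x - 2 * x * dpsi k x = (a + c\<^sup>2 * x\<^sup>2) * psi k x"
      using a[OF that] by (simp add: prolate_op_def algebra_simps)
    ultimately show ?thesis by simp
  qed
  have bound: "\<bar>(a + c\<^sup>2 * z\<^sup>2) * psi k z\<bar> \<le> C * M" if "z \<in> {b..1}" for z
  proof -
    have "z\<^sup>2 \<le> 1" using that b by (simp add: power_le_one)
    then have "c\<^sup>2 * z\<^sup>2 \<le> c\<^sup>2" by (simp add: mult_left_le)
    then have "\<bar>a + c\<^sup>2 * z\<^sup>2\<bar> \<le> C"
      unfolding C_def by (smt (verit) zero_le_power2 mult_nonneg_nonneg)
    then show ?thesis
      unfolding abs_mult M_def using max[OF that] C1 by (intro mult_mono) auto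
  qed
  have dbound: "\<bar>dpsi k x\<bar> \<le> C * M" if x: "b \<le> x" "x < 1" for x
  proof -
    obtain z where z: "x < z" "z < 1"
      and mvt: "(1 - 1\<^sup>2) * dpsi k 1 - (1 - x\<^sup>2) * dpsi k x = (1 - x) * ((a + c\<^sup>2 * z\<^sup>2) * psi k z)"
      using MVT2[of x 1 "\<lambda>x. (1 - x\<^sup>2) * dpsi k x" "\<lambda>x. (a + c\<^sup>2 * x\<^sup>2) * psi k x"] w x b by auto
    have "(1 - x\<^sup>2) * \<bar>dpsi k x\<bar> = (1 - x) * \<bar>(a + c\<^sup>2 * z\<^sup>2) * psi k z\<bar>"
    proof -
      have "\<bar>(1 - x\<^sup>2) * dpsi k x\<bar> = \<bar>(1 - x) * ((a + c\<^sup>2 * z\<^sup>2) * psi k z)\<bar>"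
        using mvt by (metis abs_minus_cancel diff_0 diff_self mult_zero_left one_power2)
      moreover have "x\<^sup>2 \<le> 1"
        using x b by (simp add: power_le_one)
      ultimately show ?thesis
        using x by (simp add: abs_mult)
    qed
    also have "\<dots> \<le> (1 - x) * (C * M)"
      using bound[of z] z x by (intro mult_left_mono) auto
    \<comment> \<open>The factor \<open>1 - x\<close> cancels against the length of the interval,
      which removes the singularity at \<open>1\<close>.\<close>
    also have "(1 - x\<^sup>2) * \<bar>dpsi k x\<bar> = (1 - x) * ((1 + x) * \<bar>dpsi k x\<bar>)"
      by (simp add: algebra_simps power2_eq_square)
    finally have "(1 + x) * \<bar>dpsi k x\<bar> \<le> C * M"
      using x by simp
    moreover have "\<bar>dpsi k x\<bar> \<le> (1 + x) * \<bar>dpsi k x\<bar>"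
      using x b by (simp add: algebra_simps)
    ultimately show ?thesis by linarith
  qed
  have "M = 0"
  proof (cases "y = 1")
    case False
    then obtain z where z: "y < z" "z < 1" "psi k 1 - psi k y = (1 - y) * dpsi k z"
      using MVT2[of y 1 "psi k" "dpsi k"] psi_has_derivative y by auto
    then have "\<bar>- psi k y\<bar> = \<bar>(1 - y) * dpsi k z\<bar>"
      using zero by simp
    then have "M = (1 - y) * \<bar>dpsi k z\<bar>"
      using y by (simp add: M_def abs_mult)
    also have "\<dots> \<le> (1 - b) * (C * M)"
      using z y dbound[of z] by (intro mult_mono) auto
    also have "\<dots> = C * (1 - b) * M"
      by (simp only: mult_ac)
    also have "\<dots> = M / 2"
      by (simp only: b(3))
    finally show ?thesis by (simp add: M_def)
  qed (simp add: M_def zero)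
  \<comment> \<open>With \<open>M = 0\<close> the function vanishes on all of
    \<open>{b<..<1}\<close>, against the finiteness of its roots.\<close>
  then have "{b<..<1} \<subseteq> {x. -1 < x \<and> x < 1 \<and> psi k x = 0}"
    using max b by (force simp: M_def)
  then have "finite {b<..<1}"
    using finite_zeros finite_subset by blast
  then show False
    using infinite_Ioo[of b 1] b by simp
qed

lemma psi_endpoints_nonzero: "\<bar>x\<bar> = 1 \<Longrightarrow> psi k x \<noteq> 0"
  using psi_one_nonzero[of k] psi_parity[of k 1] by (auto simp: abs_eq_iff')

section \<open>Division by a root and the quadrature error\<close>

text \<open>For a root \<open>t\<close> this is \<open>psi n s / (s - t)\<close> with its
  singularity removed; the integral form makes it differentiable at \<open>s = t\<close>
  too.\<close>

definition root_quot :: "nat \<Rightarrow> real \<Rightarrow> real \<Rightarrow> complex" where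
  "root_quot n t s = \<i> * c / lam n * band_transform c (exp_tail c (cpsi n) t) s"

lemma continuous_on_root_quot [continuous_intros]: "continuous_on S (root_quot n t)"
  unfolding root_quot_def[abs_def]
  by (intro continuous_intros continuous_on_band_transform continuous_on_exp_tail)

lemma root_quot_mult:
  assumes "psi n t = 0"
  shows "(s - t) * root_quot n t s = cpsi n s"
proof -
  have "\<i> * c * (s - t) * band_transform c (exp_tail c (cpsi n) t) s = lam n * cpsi n s"
    using band_transform_exp_tail[of "cpsi n" c s t] assms
    by (simp add: band_transform_psi continuous_intros)
  then have "(s - t) * (\<i> * c * band_transform c (exp_tail c (cpsi n) t) s) = lam n * cpsi n s"
    by (simp only: mult_ac)
  then show ?thesis
    by (simp add: root_quot_def)
qed

text \<open>Away from \<open>t\<close> it is a quotient of real numbers, and continuity carries this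
  over to \<open>t\<close>.\<close>

lemma root_quot_real:
  assumes "psi n t = 0"
  shows "root_quot n t s = complex_of_real (Re (root_quot n t s))"
proof -
  have "Im (root_quot n t s) = 0"
  proof (rule continuous_constant_on_closure[where S = "- {t}" and f = "\<lambda>s. Im (root_quot n t s)" and a = 0 and x = s])
    show "continuous_on (closure (- {t})) (\<lambda>s. Im (root_quot n t s))"
      by (intro continuous_intros)
    show "s \<in> closure (- {t})"
      by (simp add: closure_complement)
    fix s assume "s \<in> - {t}"
    then have "root_quot n t s = complex_of_real (psi n s / (s - t))"
      using root_quot_mult[OF assms, of s] by (simp add: field_simps)
    then show "Im (root_quot n t s) = 0" by simp
  qed
  then show ?thesis by (simp add: complex_eq_iff)
qed

lemma Re_root_quot_mult:
  assumes "psi n t = 0"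
  shows "(s - t) * Re (root_quot n t s) = psi n s"
  using root_quot_mult[OF assms, of s] root_quot_real[OF assms, of s]
  by (metis of_real_eq_iff of_real_mult of_real_diff)

lemma Re_root_quot_eq:
  assumes "psi n t = 0" "s \<noteq> t"
  shows "Re (root_quot n t s) = psi n s / (s - t)"
  using assms by (simp flip: Re_root_quot_mult[OF assms(1), of s])

lemma Re_root_quot_differentiable:
  obtains D where "((\<lambda>s. Re (root_quot n t s)) has_real_derivative D) (at x)"
proof -
  have "continuous_on {-1..1} (exp_tail c (cpsi n) t)"
    by (intro continuous_on_exp_tail continuous_intros)
  from bounded_linear.has_vector_derivative[OF bounded_linear_Re
      has_vector_derivative_mult_right[OF band_transform_has_vector_derivative[OF this, of c x], of "\<i> * c / lam n"]]
  show ?thesis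
    unfolding has_real_derivative_iff_has_vector_derivative[symmetric] root_quot_def[symmetric]
    by (rule that)
qed

text \<open>Obtained by differentiating \<open>(s - t) * Re (root_quot n t s) = psi n s\<close> at
  \<open>s = t\<close>.\<close>

lemma Re_root_quot_root:
  assumes "psi n t = 0"
  shows "Re (root_quot n t t) = dpsi n t"
proof -
  obtain D where D: "((\<lambda>s. Re (root_quot n t s)) has_real_derivative D) (at t)"
    using Re_root_quot_differentiable by blast
  have "((\<lambda>s. (s - t) * Re (root_quot n t s)) has_real_derivative Re (root_quot n t t)) (at t)"
    using DERIV_mult[OF DERIV_diff[OF DERIV_ident DERIV_const[of t]] D] by simp
  then show ?thesis
    unfolding Re_root_quot_mult[OF assms] using psi_has_derivative DERIV_unique by blast
qed

text \<open>Subtracting the left-hand side from \<open>J\<close> leaves the integral of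
  \<open>psi n s (psi m s - psi m t) / (s - t)\<close>. It and \<open>J\<close> are both expressed
  through \<open>Y\<close>, which is then eliminated.\<close>

lemma integral_psi_root_quot:
  assumes t: "psi n t = 0"
  shows "psi m t * integral {-1..1} (root_quot n t)
    = (1 - (norm (lam n))\<^sup>2 / (norm (lam m))\<^sup>2) * integral {-1..1} (\<lambda>s. cpsi m s * root_quot n t s)
      - \<i> * c * lam n * (psi m t * integral {0..1} (\<lambda>x. cpsi n x * exp (- (\<i> * c * x * t))))"
proof -
  define J where "J = integral {-1..1} (\<lambda>s. cpsi m s * root_quot n t s)"
  \<comment> \<open>\<open>Y\<close> is the complex conjugate of the integral of
    \<open>psi m\<close> times \<open>exp_tail c (cpsi n) t\<close>.\<close>
  define Y where "Y = integral {-1..1} (\<lambda>u. cpsi m u * exp_tail (-c) (cpsi n) t u)"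
  define Pn where "Pn = integral {0..1} (\<lambda>x. cpsi n x * exp (- (\<i> * c * x * t)))"
  \<comment> \<open>\<open>G s\<close> is \<open>(1 - exp (- i c (s - t))) / (i c (s - t))\<close>,
    written as an integral to be continuous at \<open>s = t\<close>. It makes \<open>f\<close> the
    difference quotient of \<open>psi m\<close> although \<open>psi m t\<close> may be
    nonzero.\<close>
  define G where "G s = integral {-1..0} (\<lambda>u::real. exp (- (\<i> * c * t * u)) * exp (\<i> * c * s * u))" for s :: real
  define f where "f s = \<i> * c / lam m * (band_transform c (exp_tail c (cpsi m) t) s - lam m * psi m t * G s)" for s
  have cphi: "continuous_on {-1..1} (exp_tail c (cpsi k) t)" for k
    by (intro continuous_on_exp_tail continuous_intros)
  have "J = \<i> * c / lam n * integral {-1..1} (\<lambda>s. cpsi m s * band_transform c (exp_tail c (cpsi n) t) s)"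
    unfolding J_def root_quot_def integral_mult_right[symmetric] by (simp add: mult_ac)
  also have "integral {-1..1} (\<lambda>s. cpsi m s * band_transform c (exp_tail c (cpsi n) t) s)
      = integral {-1..1} (\<lambda>s. exp_tail c (cpsi n) t s * band_transform c (cpsi m) s)"
    by (intro band_transform_symmetric cphi continuous_intros)
  also have "\<dots> = lam m * integral {-1..1} (\<lambda>s. cpsi m s * exp_tail c (cpsi n) t s)"
    unfolding integral_mult_right[symmetric] band_transform_psi by (simp add: mult_ac)
  finally have "J = \<i> * c / lam n * (lam m * integral {-1..1} (\<lambda>s. cpsi m s * exp_tail c (cpsi n) t s))" .
  then have "cnj J = cnj (\<i> * c / lam n * (lam m * integral {-1..1} (\<lambda>s. cpsi m s * exp_tail c (cpsi n) t s)))"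
    by simp
  also have "\<dots> = - (\<i> * c / cnj (lam n) * (cnj (lam m) * Y))"
    by (simp add: Y_def integral_cnj cnj_exp_tail)
  \<comment> \<open>\<open>J\<close> is real since its integrand is, so the conjugated formula still
    evaluates \<open>J\<close>, now in terms of \<open>Y\<close>.\<close>
  also have "cnj J = J"
  proof -
    have "cnj (root_quot n t s) = root_quot n t s" for s
      by (metis root_quot_real[OF t] complex_cnj_complex_of_real)
    then show ?thesis
      by (simp add: J_def integral_cnj)
  qed
  finally have J: "\<i> * c * cnj (lam m) * Y = - cnj (lam n) * J"
    by (simp add: field_simps)

  have G: "\<i> * c * (s - t) * G s = 1 - exp (- (\<i> * c * (s - t)))" for s
  proof -
    have "((\<lambda>u. \<i> * c * (s - t) * exp (\<i> * c * (s - t) * complex_of_real u)) has_integral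
        exp (\<i> * c * (s - t) * complex_of_real 0) - exp (\<i> * c * (s - t) * complex_of_real (-1))) {-1..0}"
      by (intro fundamental_theorem_of_calculus exp_linear_has_vector_derivative) auto
    from integral_unique[OF this] have "integral {-1..0} (\<lambda>u. \<i> * c * (s - t) * exp (\<i> * c * (s - t) * complex_of_real u))
        = 1 - exp (- (\<i> * c * (s - t)))"
      by simp
    moreover have "exp (- (\<i> * c * t * u)) * exp (\<i> * c * s * u) = exp (\<i> * c * (s - t) * complex_of_real u)" for u
      by (simp add: algebra_simps flip: exp_add)
    ultimately show ?thesis
      by (simp add: G_def)
  qed
  have cG: "continuous_on {-1..1} G"
  proof -
    have "continuous_on ({-1..1} \<times> cbox (-1) 0)
        (\<lambda>(s::real, u::real). exp (- (\<i> * c * t * u)) * exp (\<i> * c * s * complex_of_real u))"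
      unfolding split_beta by (intro continuous_intros)
    from integral_continuous_on_param[OF this] show ?thesis
      unfolding G_def[abs_def] by simp
  qed
  have f: "(s - t) * f s = cpsi m s - cpsi m t" for s
  proof -
    have T: "\<i> * c * (s - t) * band_transform c (exp_tail c (cpsi m) t) s
        = lam m * cpsi m s - exp (- (\<i> * c * (s - t))) * (lam m * cpsi m t)"
      using band_transform_exp_tail[of "cpsi m" c s t] by (simp add: band_transform_psi continuous_intros)
    have "lam m * ((s - t) * f s) = \<i> * c * (s - t) * band_transform c (exp_tail c (cpsi m) t) s
        - lam m * psi m t * (\<i> * c * (s - t) * G s)"
      by (simp add: f_def field_simps)
    also have "\<dots> = lam m * (cpsi m s - cpsi m t)"
      unfolding G T by (simp add: algebra_simps)
    finally show ?thesis by simp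
  qed
  have zero: "band_transform (-c) (cpsi n) t = 0"
    using cnj_band_transform_of_real[of c "psi n" t] t by (simp add: band_transform_psi)
  \<comment> \<open>Symmetry moves the transform onto \<open>psi n\<close>;
    \<open>integral_exp_tail_exchange\<close>, applicable because \<open>t\<close> is a root of
    \<open>psi n\<close>, then yields \<open>Y\<close> again.\<close>
  have "integral {-1..1} (\<lambda>s. cpsi n s * band_transform c (exp_tail c (cpsi m) t) s)
      = integral {-1..1} (\<lambda>u. exp_tail c (cpsi m) t u * band_transform c (cpsi n) u)"
    by (intro band_transform_symmetric cphi continuous_intros)
  also have "\<dots> = lam n * integral {-1..1} (\<lambda>u. cpsi n u * exp_tail c (cpsi m) t u)"
    unfolding integral_mult_right[symmetric] band_transform_psi by (simp add: mult_ac)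
  also have "\<dots> = - lam n * Y"
    unfolding Y_def by (subst integral_exp_tail_exchange[OF _ _ zero]) (auto intro!: continuous_intros)
  finally have A: "integral {-1..1} (\<lambda>s. cpsi n s * band_transform c (exp_tail c (cpsi m) t) s) = - lam n * Y" .
  have "integral {-1..1} (\<lambda>s. cpsi n s * G s)
      = integral {-1..0} (\<lambda>u. exp (- (\<i> * c * t * u)) * band_transform c (cpsi n) u)"
    unfolding G_def by (intro integral_exp_kernel_swap continuous_intros)
  also have "\<dots> = lam n * integral {-1..0} (\<lambda>u. cpsi n u * exp (- (\<i> * c * u * t)))"
    unfolding integral_mult_right[symmetric] band_transform_psi by (simp add: mult_ac)
  \<comment> \<open>The integral over all of \<open>{-1..1}\<close> vanishes because
    \<open>t\<close> is a root, so the left half is minus the right half.\<close>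
  also have "integral {-1..0} (\<lambda>u. cpsi n u * exp (- (\<i> * c * u * t))) = - Pn"
  proof -
    have "integral {-1..0} (\<lambda>u. cpsi n u * exp (- (\<i> * c * u * t))) + Pn
        = integral {-1..1} (\<lambda>u. cpsi n u * exp (- (\<i> * c * u * t)))"
      unfolding Pn_def by (intro Henstock_Kurzweil_Integration.integral_combine
          integrable_continuous_interval continuous_intros) auto
    also have "\<dots> = 0"
      using zero by (simp add: band_transform_def mult_ac)
    finally show ?thesis by (simp add: eq_neg_iff_add_eq_0)
  qed
  finally have B: "integral {-1..1} (\<lambda>s. cpsi n s * G s) = - lam n * Pn" by simp
  have "((\<lambda>s. \<i> * c / lam m * (cpsi n s * band_transform c (exp_tail c (cpsi m) t) s - lam m * psi m t * (cpsi n s * G s)))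
      has_integral \<i> * c / lam m * (- lam n * Y - lam m * psi m t * (- lam n * Pn))) {-1..1}"
    unfolding A[symmetric] B[symmetric]
    by (intro has_integral_diff has_integral_mult_right integrable_integral integrable_continuous_interval
        continuous_intros continuous_on_band_transform cphi cG)
  moreover have "\<i> * c / lam m * (cpsi n s * band_transform c (exp_tail c (cpsi m) t) s - lam m * psi m t * (cpsi n s * G s))
      = cpsi m s * root_quot n t s - cpsi m t * root_quot n t s" for s
  proof -
    have "\<i> * c / lam m * (cpsi n s * band_transform c (exp_tail c (cpsi m) t) s - lam m * psi m t * (cpsi n s * G s))
        = cpsi n s * f s"
      by (simp add: f_def algebra_simps)
    also have "\<dots> = root_quot n t s * ((s - t) * f s)"
      by (simp add: root_quot_mult[OF t, symmetric] mult_ac)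
    also have "\<dots> = cpsi m s * root_quot n t s - cpsi m t * root_quot n t s"
      unfolding f by (simp add: algebra_simps)
    finally show ?thesis .
  qed
  ultimately have 1: "((\<lambda>s. cpsi m s * root_quot n t s - cpsi m t * root_quot n t s)
      has_integral \<i> * c / lam m * (- lam n * Y - lam m * psi m t * (- lam n * Pn))) {-1..1}"
    by (simp only:)
  have 2: "((\<lambda>s. cpsi m s * root_quot n t s - cpsi m t * root_quot n t s)
      has_integral J - cpsi m t * integral {-1..1} (root_quot n t)) {-1..1}"
    unfolding J_def
    by (intro has_integral_diff has_integral_mult_right integrable_integral integrable_continuous_interval
        continuous_intros)
  \<comment> \<open>Two evaluations of one integral are compared. Eliminating \<open>Y\<close>
    multiplies \<open>lam n / lam m\<close> by its conjugate, whence the squared moduli.\<close>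
  have "J - cpsi m t * integral {-1..1} (root_quot n t)
      = - (lam n / lam m) * (\<i> * c * Y) + \<i> * c * lam n * (psi m t * Pn)"
    unfolding has_integral_unique[OF 2 1] by (simp add: field_simps)
  also have "\<i> * c * Y = - (cnj (lam n) / cnj (lam m)) * J"
    using J by (simp add: field_simps)
  also have "- (lam n / lam m) * (- (cnj (lam n) / cnj (lam m)) * J)
      = ((norm (lam n))\<^sup>2 / (norm (lam m))\<^sup>2) * J"
    by (simp add: complex_norm_square del: of_real_power)
  finally show ?thesis
    unfolding J_def[symmetric] Pn_def[symmetric] by (simp add: algebra_simps)
qed

section \<open>The partial fraction remainder and the error bound\<close>

text \<open>At each root the simple pole of \<open>1 / psi n\<close> is cancelled by one term of the
  sum, and at the endpoints \<open>psi n\<close> is nonzero. So limits exist throughout the closed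
  interval.\<close>

lemma roots_remainder_bounded:
  fixes n :: nat
  defines "Z \<equiv> {x. -1 < x \<and> x < 1 \<and> psi n x = 0}"
  shows "\<exists>B. \<forall>\<tau>\<in>{-1..1}. \<bar>1 / psi n \<tau> - (\<Sum>z\<in>Z. 1 / (dpsi n z * (\<tau> - z)))\<bar> \<le> B"
proof (rule bounded_image_if_limits_on_compact)
  have fin: "finite Z" unfolding Z_def by (rule finite_zeros)
  fix z :: real assume z: "z \<in> {-1..1}"
  have d: "dpsi n x \<noteq> 0" if "x \<in> Z" for x
    using simple_zeros[of x n] that by (simp add: Z_def deriv_psi)
  have psi_lim: "(psi n \<longlongrightarrow> psi n z) (at z)"
    using DERIV_isCont[OF psi_has_derivative] isContD by blast
  show "\<exists>l. ((\<lambda>\<tau>. 1 / psi n \<tau> - (\<Sum>z\<in>Z. 1 / (dpsi n z * (\<tau> - z)))) \<longlongrightarrow> l) (at z)"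
  proof (cases "z \<in> Z")
    case False
    then have "psi n z \<noteq> 0"
      using z psi_endpoints_nonzero[of z n] by (auto simp: Z_def)
    moreover have "dpsi n x * (z - x) \<noteq> 0" if "x \<in> Z" for x
      using d[OF that] that False by auto
    ultimately show ?thesis
      by (intro exI) (rule tendsto_intros psi_lim | assumption)+
  next
    case True
    then have root: "psi n z = 0" by (simp add: Z_def)
    let ?r = "\<lambda>s. Re (root_quot n z s)"
    have rz: "?r z = dpsi n z" by (rule Re_root_quot_root[OF root])
    obtain D where D: "(?r has_real_derivative D) (at z)"
      using Re_root_quot_differentiable by blast
    have "((\<lambda>s. inverse (?r s)) has_real_derivative - (inverse (?r z) * D * inverse (?r z))) (at z)"
      using DERIV_inverse'[OF D] d[OF True] rz by simp
    then obtain E where "((\<lambda>s. (inverse (?r s) - inverse (?r z)) / (s - z)) \<longlongrightarrow> E) (at z)"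
      unfolding has_field_derivative_iff by blast
    \<comment> \<open>The difference quotient of \<open>1 / ?r\<close> is \<open>1 / psi n\<close>
      minus its polar part. At \<open>s = z\<close> both sides are 0 by the convention on division
      by zero.\<close>
    moreover have "(inverse (?r s) - inverse (?r z)) / (s - z) = 1 / psi n s - 1 / (dpsi n z * (s - z))" for s
      unfolding Re_root_quot_mult[OF root, of s, symmetric] rz by (simp add: divide_simps)
    ultimately have main: "((\<lambda>s. 1 / psi n s - 1 / (dpsi n z * (s - z))) \<longlongrightarrow> E) (at z)"
      by (simp only:)
    have nz: "dpsi n x * (z - x) \<noteq> 0" if "x \<in> Z - {z}" for x
      using d[of x] that by auto
    have "((\<lambda>s. \<Sum>x\<in>Z - {z}. 1 / (dpsi n x * (s - x))) \<longlongrightarrow> (\<Sum>x\<in>Z - {z}. 1 / (dpsi n x * (z - x)))) (at z)"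
      by (intro tendsto_intros nz)
    from tendsto_diff[OF main this] show ?thesis
      using sum.remove[OF fin True, of "\<lambda>x. 1 / (dpsi n x * (_ - x))"]
      by (auto simp: algebra_simps intro!: exI)
  qed
qed simp

lemma quadrature_error:
  assumes "m \<le> n"
  defines "Z \<equiv> {x. -1 < x \<and> x < 1 \<and> psi n x = 0}"
  defines "rem \<equiv> \<lambda>\<tau>. \<bar>1 / psi n \<tau> - (\<Sum>z\<in>Z. 1 / (dpsi n z * (\<tau> - z)))\<bar>"
  defines "P \<equiv> (\<Sum>z\<in>Z. complex_of_real (psi m z / dpsi n z) * integral {0..1} (\<lambda>x. cpsi n x * exp (- (\<i> * c * x * z))))"
  shows "\<bar>integral {-1..1} (psi m) - (\<Sum>z\<in>Z. psi m z * (1 / dpsi n z * integral {-1..1} (\<lambda>s. psi n s / (s - z))))\<bar>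
    \<le> (1 - (norm (lam n))\<^sup>2 / (norm (lam m))\<^sup>2) * (SUP \<tau>\<in>{\<tau>. -1 < \<tau> \<and> \<tau> < 1 \<and> psi n \<tau> \<noteq> 0}. rem \<tau>)
      + norm (lam n) * ((norm (lam n) / norm (lam m)) * \<bar>psi m 0\<bar> + c * norm P)"
proof -
  let ?r = "\<lambda>z s. Re (root_quot n z s)"
  let ?S = "{\<tau>. -1 < \<tau> \<and> \<tau> < 1 \<and> psi n \<tau> \<noteq> 0}"
  let ?N = "SUP \<tau>\<in>?S. rem \<tau>"
  define \<rho> where "\<rho> = (norm (lam n))\<^sup>2 / (norm (lam m))\<^sup>2"
  define I where "I = integral {-1..1} (psi m)"
  define W where "W z = 1 / dpsi n z * integral {-1..1} (\<lambda>s. psi n s / (s - z))" for z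
  define J where "J z = integral {-1..1} (\<lambda>s. psi m s * ?r z s)" for z
  \<comment> \<open>\<open>I\<close> is the integral of \<open>psi m\<close>, and \<open>K\<close>
    that of \<open>psi m psi n\<close> times the partial fraction remainder, written with the
    continuous quotients \<open>?r\<close>.\<close>
  define K where "K = I - (\<Sum>z\<in>Z. J z / dpsi n z)"
  have fin: "finite Z" unfolding Z_def by (rule finite_zeros)
  have root: "psi n z = 0" if "z \<in> Z" for z using that by (simp add: Z_def)

  have bdd: "bdd_above (rem ` ?S)"
  proof -
    obtain B where "\<forall>\<tau>\<in>{-1..1}. rem \<tau> \<le> B"
      using roots_remainder_bounded[of n] unfolding rem_def Z_def by blast
    then show ?thesis
      by (intro bdd_aboveI[of _ B]) auto
  qed
  have N: "rem \<tau> \<le> ?N" if "\<tau> \<in> ?S" for \<tau>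
    by (rule cSUP_upper[OF that bdd])

  have K_bound: "\<bar>K\<bar> \<le> ?N"
  proof -
    let ?g = "\<lambda>s. psi m s - (\<Sum>z\<in>Z. psi m s * ?r z s / dpsi n z)"
    \<comment> \<open>The estimate \<open>|psi m psi n| <= (psi m^2 + psi n^2) / 2\<close> suffices:
      both functions have norm 1, so \<open>?b\<close> integrates to exactly
      \<open>?N\<close>.\<close>
    let ?b = "\<lambda>s. ((psi m s * psi m s + psi n s * psi n s) / 2) * ?N"
    \<comment> \<open>These are the points of \<open>{-1..1}\<close> outside \<open>?S\<close>,
      where the supremum gives no bound.\<close>
    let ?E = "Z \<union> {-1, 1}"
    have g: "(?g has_integral K) {-1..1}"
      unfolding K_def I_def J_def
      by (intro has_integral_diff has_integral_sum has_integral_divide fin integrable_integral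
          integrable_continuous_interval continuous_intros)
    have "(?b has_integral ((integral {-1..1} (\<lambda>s. psi m s * psi m s) + integral {-1..1} (\<lambda>s. psi n s * psi n s)) / 2) * ?N) {-1..1}"
      by (intro has_integral_add has_integral_divide has_integral_mult_left integrable_integral
          integrable_continuous_interval continuous_intros)
    then have b: "(?b has_integral ?N) {-1..1}"
      by (simp add: psi_orthonormal)
    have neg: "negligible ?E"
      using fin by (intro negligible_finite) auto
    have pt: "norm (?g s) \<le> ?b s" if s: "s \<in> {-1..1} - ?E" for s
    proof -
      have sS: "s \<in> ?S" and nz: "psi n s \<noteq> 0" using s by (auto simp: Z_def)
      have "?r z s = psi n s / (s - z)" if "z \<in> Z" for z
        using s that by (intro Re_root_quot_eq root) auto
      then have "?g s = psi m s * psi n s * (1 / psi n s - (\<Sum>z\<in>Z. 1 / (dpsi n z * (s - z))))"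
        using nz by (simp add: right_diff_distrib sum_distrib_left mult_ac cong: sum.cong)
      then have "\<bar>?g s\<bar> = \<bar>psi m s * psi n s\<bar> * rem s"
        by (simp only: abs_mult rem_def)
      also have "\<dots> \<le> ((psi m s * psi m s + psi n s * psi n s) / 2) * ?N"
      proof (intro mult_mono N[OF sS])
        have "0 \<le> (\<bar>psi m s\<bar> - \<bar>psi n s\<bar>)\<^sup>2" by simp
        then show "\<bar>psi m s * psi n s\<bar> \<le> (psi m s * psi m s + psi n s * psi n s) / 2"
          by (simp add: power2_eq_square algebra_simps abs_mult)
      qed (auto simp: rem_def)
      finally show ?thesis by simp
    qed
    have g0: "((\<lambda>s. if s \<in> ?E then 0 else ?g s) has_integral K) {-1..1}"
      by (rule has_integral_spike[OF neg _ g]) auto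
    have b0: "((\<lambda>s. if s \<in> ?E then 0 else ?b s) has_integral ?N) {-1..1}"
      by (rule has_integral_spike[OF neg _ b]) auto
    have "norm (integral {-1..1} (\<lambda>s. if s \<in> ?E then 0 else ?g s))
        \<le> integral {-1..1} (\<lambda>s. if s \<in> ?E then 0 else ?b s)"
    proof (rule integral_norm_bound_integral)
      show "norm (if s \<in> ?E then 0 else ?g s) \<le> (if s \<in> ?E then 0 else ?b s)" if "s \<in> {-1..1}" for s
        using pt[of s] that by (cases "s \<in> ?E") simp_all
    qed (use g0 b0 in \<open>auto simp: integrable_on_def\<close>)
    then show ?thesis
      unfolding integral_unique[OF g0] integral_unique[OF b0] by simp
  qed

  have node: "complex_of_real (psi m z * W z) = (1 - \<rho>) * complex_of_real (J z / dpsi n z)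
      - \<i> * c * lam n * (complex_of_real (psi m z / dpsi n z) * integral {0..1} (\<lambda>x. cpsi n x * exp (- (\<i> * c * x * z))))"
    if z: "z \<in> Z" for z
  proof -
    have "integral {-1..1} (\<lambda>s. psi n s / (s - z)) = integral {-1..1} (?r z)"
    proof (rule integral_spike[of "{z}"])
      fix s assume "s \<in> {-1..1} - {z}"
      then show "?r z s = psi n s / (s - z)"
        using z by (intro Re_root_quot_eq root) auto
    qed simp
    moreover have "integral {-1..1} (root_quot n z) = complex_of_real (integral {-1..1} (?r z))"
      by (subst integral_complex_of_real_HK[symmetric])
         (auto intro!: integrable_continuous_interval continuous_intros simp flip: root_quot_real[OF root[OF z]])
    ultimately have W: "complex_of_real (W z) = integral {-1..1} (root_quot n z) / dpsi n z"
      by (simp add: W_def)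
    have J: "complex_of_real (J z) = integral {-1..1} (\<lambda>s. cpsi m s * root_quot n z s)"
      unfolding J_def
      by (subst integral_complex_of_real_HK[symmetric])
         (auto intro!: integrable_continuous_interval continuous_intros simp flip: root_quot_real[OF root[OF z]])
    have "complex_of_real (psi m z * W z) = (psi m z * integral {-1..1} (root_quot n z)) / dpsi n z"
      by (simp add: W)
    also have "\<dots> = (1 - \<rho>) * complex_of_real (J z / dpsi n z)
      - \<i> * c * lam n * (complex_of_real (psi m z / dpsi n z) * integral {0..1} (\<lambda>x. cpsi n x * exp (- (\<i> * c * x * z))))"
      unfolding integral_psi_root_quot[OF root[OF z]]
      by (simp add: J \<rho>_def diff_divide_distrib)
    finally show ?thesis .
  qed

  \<comment> \<open>The sum of \<open>J z / dpsi n z\<close> is \<open>I - K\<close> by the choice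
    of \<open>K\<close>; the outcome is the exact error, before any estimate.\<close>
  have "complex_of_real (\<Sum>z\<in>Z. psi m z * W z) = (\<Sum>z\<in>Z. (1 - \<rho>) * complex_of_real (J z / dpsi n z)
      - \<i> * c * lam n * (complex_of_real (psi m z / dpsi n z) * integral {0..1} (\<lambda>x. cpsi n x * exp (- (\<i> * c * x * z)))))"
    unfolding of_real_sum by (intro sum.cong refl node)
  also have "\<dots> = (1 - \<rho>) * complex_of_real (I - K) - \<i> * c * lam n * P"
    unfolding P_def K_def by (simp add: sum_subtractf sum_distrib_left)
  finally have total: "complex_of_real (I - (\<Sum>z\<in>Z. psi m z * W z))
      = \<rho> * I + (1 - \<rho>) * K + \<i> * c * lam n * P"
    by (simp add: algebra_simps)

  \<comment> \<open>The eigenvalue equation at \<open>0\<close>, where the kernel is 1.\<close>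
  have "complex_of_real I = lam m * psi m 0"
    using band_transform_psi[of m 0] unfolding I_def
    by (subst integral_complex_of_real_HK[symmetric])
       (auto intro!: integrable_continuous_interval continuous_intros simp: band_transform_def)
  then have I_abs: "\<bar>I\<bar> = norm (lam m) * \<bar>psi m 0\<bar>"
    by (metis norm_mult norm_of_real)
  \<comment> \<open>The moduli of the eigenvalues decrease, so \<open>1 - \<rho>\<close> is
    nonnegative and the bound on \<open>K\<close> may be multiplied by it.\<close>
  have \<rho>: "0 \<le> \<rho>" "\<rho> \<le> 1"
    using norm_lam_antimono[OF \<open>m \<le> n\<close>] by (auto simp: \<rho>_def divide_le_eq power_mono)
  have "\<bar>I - (\<Sum>z\<in>Z. psi m z * W z)\<bar> = norm (\<rho> * I + (1 - \<rho>) * K + \<i> * c * lam n * P)"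
    unfolding total[symmetric] norm_of_real ..
  also have "\<dots> \<le> norm (complex_of_real (\<rho> * I)) + norm (complex_of_real ((1 - \<rho>) * K)) + norm (\<i> * c * lam n * P)"
    unfolding of_real_add
    by (intro norm_triangle_mono norm_triangle_ineq order_refl)
  also have "\<dots> = \<rho> * \<bar>I\<bar> + (1 - \<rho>) * \<bar>K\<bar> + c * norm (lam n) * norm P"
    using \<rho> c_pos unfolding norm_of_real abs_mult by (simp add: norm_mult)
  also have "\<dots> \<le> \<rho> * \<bar>I\<bar> + (1 - \<rho>) * ?N + c * norm (lam n) * norm P"
    using K_bound \<rho> c_pos by (intro add_mono mult_left_mono) auto
  also have "\<dots> = (1 - \<rho>) * ?N + norm (lam n) * ((norm (lam n) / norm (lam m)) * \<bar>psi m 0\<bar> + c * norm P)"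
    unfolding I_abs \<rho>_def by (simp add: field_simps power2_eq_square)
  finally show ?thesis
    unfolding I_def W_def \<rho>_def .
qed

end

theorem theorem60:
  fixes c :: real and lam :: "nat \<Rightarrow> complex" and psi :: "nat \<Rightarrow> real \<Rightarrow> real"
    and n m :: nat and t :: "nat \<Rightarrow> real"
  assumes sys: "pswf_system c lam psi"
    and n_pos: "n > 0" and m_le: "m \<le> n - 1"
    and t_mono: "\<And>i j. 1 \<le> i \<Longrightarrow> i < j \<Longrightarrow> j \<le> n \<Longrightarrow> t i < t j"
    and t_roots: "{x. -1 < x \<and> x < 1 \<and> psi n x = 0} = t ` {1..n}"
  defines "W \<equiv> \<lambda>j. (1 / deriv (psi n) (t j)) * integral {-1..1} (\<lambda>s. psi n s / (s - t j))"
    and "P \<equiv> (\<Sum>j=1..n. complex_of_real (psi m (t j) / deriv (psi n) (t j)) * integral {0..1} (\<lambda>x. complex_of_real (psi n x) * exp (- (\<i> * c * x * t j))))"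
    and "Inorm \<equiv> Sup ((\<lambda>\<tau>. \<bar>1 / psi n \<tau> - (\<Sum>j=1..n. 1 / (deriv (psi n) (t j) * (\<tau> - t j)))\<bar>) ` {\<tau>. -1 < \<tau> \<and> \<tau> < 1 \<and> psi n \<tau> \<noteq> 0})"
  shows "\<bar>integral {-1..1} (psi m) - (\<Sum>j=1..n. psi m (t j) * W j)\<bar>
         \<le> (1 - (norm (lam n))^2 / (norm (lam m))^2) * Inorm
            + norm (lam n) * ((norm (lam n) / norm (lam m)) * \<bar>psi m 0\<bar> + c * norm P)"
proof -
  interpret pswf c lam psi by unfold_locales (rule sys)
  \<comment> \<open>Strict monotonicity makes \<open>t\<close> injective, so sums over the set of
    roots become sums over the indices.\<close>
  have "inj_on t {1..n}"
    by (rule linorder_inj_onI') (use t_mono in force)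
  then have reindex: "(\<Sum>z\<in>t ` {1..n}. F z) = (\<Sum>j=1..n. F (t j))" for F :: "real \<Rightarrow> 'a::comm_monoid_add"
    by (simp add: sum.reindex)
  show ?thesis
    using quadrature_error[of m n] m_le
    unfolding t_roots reindex deriv_psi[symmetric] W_def P_def Inorm_def by simp
qed

end
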